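(* Let $E$ be an arbitrary directed graph. The following conditions are equivalent. (1) Every nonzero element $a\in F_E^\Gamma$ is aperiodic. (2) Every generator of $F_E^\Gamma$ is aperiodic. (3) Every generator of $F_E^\Gamma$ is comparable and every cycle of $E$ has an exit. (4) For every generator $g$ of $F_E^\Gamma$, $g\to a$ for some stationary element $a$ such that all core cycles of $a$ have exits.
   Context: Setup. $\Gamma=\{x^n\mid n\in\mathbb Z\}$ is the infinite cyclic group generated by $x$. $E$ is an arbitrary directed graph with vertex set $E^0$, edge set $E^1$, source map $\mathbf s$ and range map $\mathbf r$. A vertex $v$ is a sink if $\mathbf s^{-1}(v)=\emptyset$, regular if $\mathbf s^{-1}(v)$ is finite and nonempty, and an infinite emitter if $\mathbf s^{-1}(v)$ is infinite. For every infinite emitter $v$ and every finite nonempty $Z\subseteq \mathbf s^{-1}(v)$ introduce a symbol $q_Z=q_Z^v$, called an improper vertex; elements of $E^0$ are called proper vertices. $F_E^\Gamma$ is the free commutative $\Gamma$-monoid on all proper and improper vertices (these are called the generators): its elements are finite formal sums of monomials $x^m g$ ($m\in\mathbb Z$, $g$ a generator), and $x^n$ acts by $x^n(x^m g)=x^{n+m}g$. The support of an element is the set of generators occurring in it. The relation $\to_1$ on $F_E^\Gamma-\{0\}$ is given, for all $a\in F_E^\Gamma$ and $m\in\mathbb Z$, by: (A1) $a+x^m v\to_1 a+\sum_{e\in \mathbf s^{-1}(v)}x^{m+1}\mathbf r(e)$ for $v$ regular; (A2) $a+x^m v\to_1 a+x^m q_Z+\sum_{e\in Z}x^{m+1}\mathbf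 r(e)$ for $v$ an infinite emitter and $Z\subseteq \mathbf s^{-1}(v)$ finite and nonempty; (A3) $a+x^m q_Z\to_1 a+x^m q_W+\sum_{e\in W-Z}x^{m+1}\mathbf r(e)$ for $v$ an infinite emitter and finite nonempty $Z\subsetneq W\subseteq \mathbf s^{-1}(v)$. The relation $\to$ is the reflexive and transitive closure of $\to_1$ on $F_E^\Gamma$, and $\sim$ is the congruence on $F_E^\Gamma$ generated by $\to$. For $a,b\in F_E^\Gamma$, $a\precsim b$ (also $b\succsim a$) means that $a+c\sim b$ for some $c\in F_E^\Gamma$; $a\prec b$ (also $b\succ a$) means $a\precsim b$ and not $a\sim b$. An element $a$ is comparable if $a\succsim x^n a$ for some positive integer $n$; aperiodic if $a\succ x^n a$ for some positive integer $n$. An element $a\in F_E^\Gamma-\{0\}$ is stationary if $a\to x^n a+b$ for some positive integer $n$ and some $b\in F_E^\Gamma$. A cycle is a closed path $e_1\cdots e_n$, $n\geq 1$, with $\mathbf s(e_i)\neq \mathbf s(e_j)$ for $i\ne j$. A cycle has an exit if some vertex on it emits an edge which is not on the cycle. A cycle contains a proper vertex $v$ if $v$ is a vertex of the cycle; it contains an improper vertex $q^v_Z$ if $v$ is a vertex of the cycle and the edge of the cycle with source $v$ is not in $Z$. The core cycles of a stationary element $a$ are the cycles which contain a generator from the support of $a$. *)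

theory Defs
  imports "Graph_Theory.Digraph" "Graph_Theory.Arc_Walk" "HOL-Library.Multiset"
begin

text \<open>
  The directed graph \<open>E\<close> (infinite, with loops and parallel edges allowed) is a \<open>wf_digraph\<close>;
  the source and range maps are \<open>tail E\<close> and \<open>head E\<close>.
\<close>

definition regular_vertex :: "('v, 'e) pre_digraph \<Rightarrow> 'v \<Rightarrow> bool" where
  "regular_vertex E v \<longleftrightarrow> v \<in> verts E \<and> finite (out_arcs E v) \<and> out_arcs E v \<noteq> {}"

definition infinite_emitter :: "('v, 'e) pre_digraph \<Rightarrow> 'v \<Rightarrow> bool" where
  "infinite_emitter E v \<longleftrightarrow> v \<in> verts E \<and> infinite (out_arcs E v)"

text \<open>\<open>Improper v Z\<close> is the symbol \<open>q\<^sub>Z\<^sup>v\<close>.\<close>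

datatype ('v, 'e) generator = Proper 'v | Improper 'v "'e set"

definition generators :: "('v, 'e) pre_digraph \<Rightarrow> ('v, 'e) generator set" where
  "generators E = Proper ` verts E \<union>
     {Improper v Z | v Z. infinite_emitter E v \<and> finite Z \<and> Z \<noteq> {} \<and> Z \<subseteq> out_arcs E v}"

text \<open>
  A finite formal sum of monomials \<open>x\<^sup>m g\<close> is the multiset of the pairs \<open>(m, g)\<close>: the exponent
  \<open>m\<close> stands for the element \<open>x\<^sup>m\<close> of the infinite cyclic group \<open>\<Gamma>\<close>. The type contains
  sums over arbitrary symbols; \<open>F\<^sub>\<Gamma> E\<close> is the carrier of the free commutative \<open>\<Gamma>\<close>-monoid
  on \<open>generators E\<close>, with multiset addition.
\<close>

type_synonym ('v, 'e) elt = "(int \<times> ('v, 'e) generator) multiset"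

definition F\<^sub>\<Gamma> :: "('v, 'e) pre_digraph \<Rightarrow> ('v, 'e) elt set" where
  "F\<^sub>\<Gamma> E = {a. \<forall>(m, g) \<in># a. g \<in> generators E}"

abbreviation monomial :: "int \<Rightarrow> ('v, 'e) generator \<Rightarrow> ('v, 'e) elt" where
  "monomial m g \<equiv> {#(m, g)#}"

definition act :: "int \<Rightarrow> ('v, 'e) elt \<Rightarrow> ('v, 'e) elt" where
  "act n a = image_mset (\<lambda>(m, g). (n + m, g)) a"

definition support :: "('v, 'e) elt \<Rightarrow> ('v, 'e) generator set" where
  "support a = snd ` set_mset a"

inductive arrow1 :: "('v, 'e) pre_digraph \<Rightarrow> ('v, 'e) elt \<Rightarrow> ('v, 'e) elt \<Rightarrow> bool"
  for E :: "('v, 'e) pre_digraph" where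
  A1: "a \<in> F\<^sub>\<Gamma> E \<Longrightarrow> regular_vertex E v \<Longrightarrow>
       arrow1 E (a + monomial m (Proper v))
                (a + (\<Sum>e \<in> out_arcs E v. monomial (m + 1) (Proper (head E e))))"
| A2: "a \<in> F\<^sub>\<Gamma> E \<Longrightarrow> infinite_emitter E v \<Longrightarrow> finite Z \<Longrightarrow> Z \<noteq> {} \<Longrightarrow> Z \<subseteq> out_arcs E v \<Longrightarrow>
       arrow1 E (a + monomial m (Proper v))
                (a + monomial m (Improper v Z) + (\<Sum>e \<in> Z. monomial (m + 1) (Proper (head E e))))"
| A3: "a \<in> F\<^sub>\<Gamma> E \<Longrightarrow> infinite_emitter E v \<Longrightarrow> finite W \<Longrightarrow> Z \<noteq> {} \<Longrightarrow> Z \<subset> W \<Longrightarrow> W \<subseteq> out_arcs E v \<Longrightarrow>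
       arrow1 E (a + monomial m (Improper v Z))
                (a + monomial m (Improper v W) + (\<Sum>e \<in> W - Z. monomial (m + 1) (Proper (head E e))))"

text \<open>The guard confines the reflexive closure to the carrier.\<close>

definition arrow :: "('v, 'e) pre_digraph \<Rightarrow> ('v, 'e) elt \<Rightarrow> ('v, 'e) elt \<Rightarrow> bool" where
  "arrow E a b \<longleftrightarrow> a \<in> F\<^sub>\<Gamma> E \<and> (arrow1 E)\<^sup>*\<^sup>* a b"

text \<open>The least congruence of the \<open>\<Gamma>\<close>-monoid \<open>F\<^sub>\<Gamma> E\<close> containing \<open>arrow E\<close>.\<close>

inductive sim :: "('v, 'e) pre_digraph \<Rightarrow> ('v, 'e) elt \<Rightarrow> ('v, 'e) elt \<Rightarrow> bool"
  for E :: "('v, 'e) pre_digraph" where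
  sim_arrow: "arrow E a b \<Longrightarrow> sim E a b"
| sim_refl: "a \<in> F\<^sub>\<Gamma> E \<Longrightarrow> sim E a a"
| sim_sym: "sim E a b \<Longrightarrow> sim E b a"
| sim_trans: "sim E a b \<Longrightarrow> sim E b c \<Longrightarrow> sim E a c"
| sim_add: "sim E a b \<Longrightarrow> sim E c d \<Longrightarrow> sim E (a + c) (b + d)"
| sim_act: "sim E a b \<Longrightarrow> sim E (act n a) (act n b)"

definition precsim :: "('v, 'e) pre_digraph \<Rightarrow> ('v, 'e) elt \<Rightarrow> ('v, 'e) elt \<Rightarrow> bool" where
  "precsim E a b \<longleftrightarrow> (\<exists>c \<in> F\<^sub>\<Gamma> E. sim E (a + c) b)"

definition prec :: "('v, 'e) pre_digraph \<Rightarrow> ('v, 'e) elt \<Rightarrow> ('v, 'e) elt \<Rightarrow> bool" where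
  "prec E a b \<longleftrightarrow> precsim E a b \<and> \<not> sim E a b"

definition comparable :: "('v, 'e) pre_digraph \<Rightarrow> ('v, 'e) elt \<Rightarrow> bool" where
  "comparable E a \<longleftrightarrow> (\<exists>n > (0::int). precsim E (act n a) a)"

definition aperiodic :: "('v, 'e) pre_digraph \<Rightarrow> ('v, 'e) elt \<Rightarrow> bool" where
  "aperiodic E a \<longleftrightarrow> (\<exists>n > (0::int). prec E (act n a) a)"

definition stationary :: "('v, 'e) pre_digraph \<Rightarrow> ('v, 'e) elt \<Rightarrow> bool" where
  "stationary E a \<longleftrightarrow> a \<in> F\<^sub>\<Gamma> E \<and> a \<noteq> {#} \<and> (\<exists>n > (0::int). \<exists>b \<in> F\<^sub>\<Gamma> E. arrow E a (act n a + b))"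

text \<open>
  Cycles are those of \<open>Graph_Theory\<close>, as lists of edges. They are the nonempty closed
  paths whose edges have pairwise distinct sources; in particular, loops are cycles.
\<close>

lemma cycle_iff_distinct_sources:
  "pre_digraph.cycle E p \<longleftrightarrow>
     p \<noteq> [] \<and> (\<exists>u. pre_digraph.awalk E u p u) \<and> distinct (map (tail E) p)"
proof -
  interpret pre_digraph E .
  have *: "awalk_verts u p = map (tail E) p @ [u]" if "cas u p u" for u
  proof -
    have "awalk_verts w p = map (tail E) p @ [u]" if "cas w p u" for w
      using that by (induction p arbitrary: w) auto
    with that show ?thesis by blast
  qed
  have "distinct (tl (awalk_verts u p)) \<longleftrightarrow> distinct (map (tail E) p)"
    if "awalk u p u" "p \<noteq> []" for u
    using that *[of u] by (cases p) (auto simp: awalk_def)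
  then show ?thesis
    unfolding cycle_def by blast
qed

definition has_exit :: "('v, 'e) pre_digraph \<Rightarrow> 'e list \<Rightarrow> bool" where
  "has_exit E p \<longleftrightarrow> (\<exists>v \<in> tail E ` set p. \<exists>e \<in> out_arcs E v. e \<notin> set p)"

fun contains :: "('v, 'e) pre_digraph \<Rightarrow> 'e list \<Rightarrow> ('v, 'e) generator \<Rightarrow> bool" where
  "contains E p (Proper v) \<longleftrightarrow> v \<in> tail E ` set p"
| "contains E p (Improper v Z) \<longleftrightarrow> (\<exists>e \<in> set p. tail E e = v \<and> e \<notin> Z)"

definition core_cycle :: "('v, 'e) pre_digraph \<Rightarrow> ('v, 'e) elt \<Rightarrow> 'e list \<Rightarrow> bool" where
  "core_cycle E a p \<longleftrightarrow> pre_digraph.cycle E p \<and> (\<exists>g \<in> support a. contains E p g)"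

end

theory Submission
  imports Defs
begin

text \<open>
  Fix a finite set \<open>A\<close> of edges and a degree \<open>L\<close>. Expanding every monomial of degree below \<open>L\<close>
  as far as possible, where an infinite emitter \<open>v\<close> splits off exactly the edges in
  \<open>A \<inter> s\<^sup>-\<^sup>1(v)\<close>, defines an additive map \<open>expand A L\<close> with \<open>a \<rightarrow> expand A L a\<close> and
  \<open>x\<^sup>n (expand A L a) = expand A (n + L) (x\<^sup>n a)\<close>. If \<open>a \<sim> b\<close>, then \<open>expand A L a = expand A L b\<close>
  for some finite \<open>A\<close> and all large \<open>L\<close>, which makes \<open>\<rightarrow>\<close> confluent. Expansion does not shrink
  the number of monomials, so \<open>a \<sim> a + b\<close> forces \<open>b = 0\<close>.

  If \<open>x\<^sup>n g + c \<sim> g\<close> and \<open>s = expand A L g\<close>, then \<open>s \<rightarrow> expand A (n + L) g = x\<^sup>n s + b\<close>, so \<open>g\<close>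
  flows to the stationary element \<open>s\<close>. Conversely, let \<open>a \<rightarrow> s \<rightarrow> x\<^sup>n s + b\<close>. Then
  \<open>x\<^sup>n a + b \<sim> a\<close>, and \<open>x\<^sup>n a \<sim> a\<close> would give \<open>s \<sim> s + b\<close>, hence \<open>b = 0\<close> and \<open>s \<rightarrow> x\<^sup>n s\<close>.
  The latter uses only vertices that emit a single edge, which yields a core cycle without exits.
\<close>

section \<open>The shift action and the carrier\<close>

lemma act_empty [simp]: "act n {#} = {#}"
  by (simp add: act_def)

lemma act_eq_empty_iff [simp]: "act n a = {#} \<longleftrightarrow> a = {#}"
  by (simp add: act_def)

lemma act_add [simp]: "act n (a + b) = act n a + act n b"
  by (simp add: act_def)

lemma act_add_mset [simp]: "act n (add_mset (m, g) a) = add_mset (n + m, g) (act n a)"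
  by (simp add: act_def)

lemma act_zero [simp]: "act 0 a = a"
  by (induction a) auto

lemma act_act [simp]: "act n (act m a) = act (n + m) a"
  by (induction a) (auto simp: add.assoc)

lemma size_act [simp]: "size (act n a) = size a"
  by (simp add: act_def)

lemma act_sum_mset: "act n (\<Sum>\<^sub># M) = (\<Sum>a \<in># M. act n a)"
  by (induction M) auto

lemma mem_act_iff: "(m, g) \<in># act n a \<longleftrightarrow> (m - n, g) \<in># a"
  by (force simp: act_def)

lemma F_empty [simp]: "{#} \<in> F\<^sub>\<Gamma> E"
  by (simp add: F\<^sub>\<Gamma>_def)

lemma F_add_iff [simp]: "a + b \<in> F\<^sub>\<Gamma> E \<longleftrightarrow> a \<in> F\<^sub>\<Gamma> E \<and> b \<in> F\<^sub>\<Gamma> E"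
  by (auto simp: F\<^sub>\<Gamma>_def)

lemma F_add_mset_iff [simp]: "add_mset (m, g) a \<in> F\<^sub>\<Gamma> E \<longleftrightarrow> g \<in> generators E \<and> a \<in> F\<^sub>\<Gamma> E"
  by (auto simp: F\<^sub>\<Gamma>_def)

lemma F_act_iff [simp]: "act n a \<in> F\<^sub>\<Gamma> E \<longleftrightarrow> a \<in> F\<^sub>\<Gamma> E"
  by (induction a) auto

context wf_digraph
begin

text \<open>Phrased as an image of \<open>mset_set\<close> rather than as a sum, so that shifts,
  cardinalities and disjoint unions simplify directly.\<close>

definition targets :: "int \<Rightarrow> 'b set \<Rightarrow> ('a, 'b) elt" where
  "targets m Z = image_mset (\<lambda>e. (m + 1, Proper (head G e))) (mset_set Z)"

lemma sum_monomials: "(\<Sum>e \<in> Z. monomial (m + 1) (Proper (head G e))) = targets m Z"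
  by (simp add: sum_unfold_sum_mset targets_def)

lemma act_targets [simp]: "act n (targets m Z) = targets (n + m) Z"
  by (simp add: act_def targets_def image_mset.compositionality o_def add.assoc)

lemma size_targets [simp]: "size (targets m Z) = card Z"
  by (simp add: targets_def)

lemma targets_Un_disjoint:
  "finite Z \<Longrightarrow> finite W \<Longrightarrow> Z \<inter> W = {} \<Longrightarrow> targets m (Z \<union> W) = targets m Z + targets m W"
  by (simp add: targets_def mset_set_Union)

lemma targets_Diff:
  assumes "finite W" "Z \<subseteq> W"
  shows "targets m W = targets m Z + targets m (W - Z)"
proof -
  have "W = Z \<union> (W - Z)"
    using assms by blast
  with assms show ?thesis
    by (metis Diff_disjoint finite_Diff finite_subset targets_Un_disjoint)
qed

lemma targets_in_F:
  assumes "Z \<subseteq> out_arcs G v"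
  shows "targets m Z \<in> F\<^sub>\<Gamma> G"
proof (cases "finite Z")
  case True
  then show ?thesis
    using assms by (auto simp: F\<^sub>\<Gamma>_def targets_def generators_def)
qed (simp add: targets_def)

lemma Proper_in_generators [simp]: "Proper v \<in> generators G \<longleftrightarrow> v \<in> verts G"
  by (auto simp: generators_def)

lemma Improper_in_generators [simp]:
  "Improper v Z \<in> generators G \<longleftrightarrow>
     infinite_emitter G v \<and> finite Z \<and> Z \<noteq> {} \<and> Z \<subseteq> out_arcs G v"
  by (auto simp: generators_def)

section \<open>Compatibility of the rewriting relation with sums, shifts and size\<close>

lemmas arrow1_intros = arrow1.intros[of _ G, unfolded sum_monomials]

lemma arrow1_induct [consumes 1, case_names A1 A2 A3]:
  assumes "arrow1 G x y"
    and "\<And>a v m. a \<in> F\<^sub>\<Gamma> G \<Longrightarrow> regular_vertex G v \<Longrightarrow>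
      P (a + monomial m (Proper v)) (a + targets m (out_arcs G v))"
    and "\<And>a v Z m. a \<in> F\<^sub>\<Gamma> G \<Longrightarrow> infinite_emitter G v \<Longrightarrow> finite Z \<Longrightarrow> Z \<noteq> {} \<Longrightarrow>
      Z \<subseteq> out_arcs G v \<Longrightarrow>
      P (a + monomial m (Proper v)) (a + monomial m (Improper v Z) + targets m Z)"
    and "\<And>a v W Z m. a \<in> F\<^sub>\<Gamma> G \<Longrightarrow> infinite_emitter G v \<Longrightarrow> finite W \<Longrightarrow> Z \<noteq> {} \<Longrightarrow>
      Z \<subset> W \<Longrightarrow> W \<subseteq> out_arcs G v \<Longrightarrow>
      P (a + monomial m (Improper v Z)) (a + monomial m (Improper v W) + targets m (W - Z))"
  shows "P x y"
  using assms(1)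
proof (cases rule: arrow1.cases)
  case (A1 a v m)
  with assms(2) show ?thesis by (simp only: sum_monomials)
next
  case (A2 a v Z m)
  with assms(3) show ?thesis by (simp only: sum_monomials simp_thms)
next
  case (A3 a v W Z m)
  with assms(4) show ?thesis by (simp only: sum_monomials simp_thms)
qed

lemma arrow1_F:
  assumes "arrow1 G a b"
  shows "a \<in> F\<^sub>\<Gamma> G" "b \<in> F\<^sub>\<Gamma> G"
proof -
  have "a \<in> F\<^sub>\<Gamma> G \<and> b \<in> F\<^sub>\<Gamma> G"
    using assms
  proof (induction rule: arrow1_induct)
    case (A3 a v W Z m)
    then show ?case
      by (auto simp: infinite_emitter_def intro: finite_subset[of Z W] targets_in_F[of _ v])
  qed (auto simp: regular_vertex_def infinite_emitter_def intro: targets_in_F)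
  then show "a \<in> F\<^sub>\<Gamma> G" "b \<in> F\<^sub>\<Gamma> G"
    by auto
qed

lemma arrow1_add:
  assumes "arrow1 G a b" "c \<in> F\<^sub>\<Gamma> G"
  shows "arrow1 G (c + a) (c + b)"
  using assms
proof (induction rule: arrow1_induct)
  case (A1 a v m)
  then show ?case using arrow1_intros(1)[of "c + a" v m] by (simp add: ac_simps)
next
  case (A2 a v Z m)
  then show ?case using arrow1_intros(2)[of "c + a" v Z m] by (simp add: ac_simps)
next
  case (A3 a v W Z m)
  then show ?case using arrow1_intros(3)[of "c + a" v W Z m] by (simp add: ac_simps)
qed

lemma arrow1_act:
  assumes "arrow1 G a b"
  shows "arrow1 G (act n a) (act n b)"
  using assms
proof (induction rule: arrow1_induct)
  case (A1 a v m)
  then show ?case using arrow1_intros(1)[of "act n a" v "n + m"] by simp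
next
  case (A2 a v Z m)
  then show ?case using arrow1_intros(2)[of "act n a" v Z "n + m"] by simp
next
  case (A3 a v W Z m)
  then show ?case using arrow1_intros(3)[of "act n a" v W Z "n + m"] by simp
qed

lemma arrow_refl: "a \<in> F\<^sub>\<Gamma> G \<Longrightarrow> arrow G a a"
  by (simp add: arrow_def)

lemma arrow1_imp_arrow: "arrow1 G a b \<Longrightarrow> arrow G a b"
  by (simp add: arrow_def arrow1_F)

lemma arrow_trans: "arrow G a b \<Longrightarrow> arrow G b c \<Longrightarrow> arrow G a c"
  by (auto simp: arrow_def)

lemma arrow_F:
  assumes "arrow G a b"
  shows "a \<in> F\<^sub>\<Gamma> G" "b \<in> F\<^sub>\<Gamma> G"
proof -
  show "a \<in> F\<^sub>\<Gamma> G"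
    using assms by (simp add: arrow_def)
  from assms have "(arrow1 G)\<^sup>*\<^sup>* a b"
    by (simp add: arrow_def)
  then show "b \<in> F\<^sub>\<Gamma> G"
    using \<open>a \<in> F\<^sub>\<Gamma> G\<close> by induction (auto dest: arrow1_F)
qed

lemma arrow_add_left:
  assumes "arrow G a b" "c \<in> F\<^sub>\<Gamma> G"
  shows "arrow G (c + a) (c + b)"
proof -
  from assms(1) have "(arrow1 G)\<^sup>*\<^sup>* a b"
    by (simp add: arrow_def)
  then have "(arrow1 G)\<^sup>*\<^sup>* (c + a) (c + b)"
    by induction (auto intro: rtranclp.rtrancl_into_rtrancl arrow1_add assms(2))
  with assms show ?thesis
    by (simp add: arrow_def)
qed

lemma arrow_add:
  assumes "arrow G a b" "arrow G c d"
  shows "arrow G (a + c) (b + d)"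
proof -
  have "arrow G (a + c) (b + c)"
    using arrow_add_left[OF assms(1), of c] arrow_F assms by (simp add: ac_simps)
  moreover have "arrow G (b + c) (b + d)"
    using arrow_add_left assms arrow_F by blast
  ultimately show ?thesis
    by (rule arrow_trans)
qed

lemma arrow_act:
  assumes "arrow G a b"
  shows "arrow G (act n a) (act n b)"
proof -
  from assms have "(arrow1 G)\<^sup>*\<^sup>* a b"
    by (simp add: arrow_def)
  then have "(arrow1 G)\<^sup>*\<^sup>* (act n a) (act n b)"
    by induction (auto intro: rtranclp.rtrancl_into_rtrancl arrow1_act)
  with assms show ?thesis
    by (simp add: arrow_def)
qed

lemma arrow_sum_mset:
  assumes "\<And>x. x \<in># M \<Longrightarrow> arrow G {#x#} (f x)"
  shows "arrow G M (\<Sum>x \<in># M. f x)"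
  using assms
proof (induction M)
  case (add x M)
  then have "arrow G ({#x#} + M) (f x + (\<Sum>x \<in># M. f x))"
    by (intro arrow_add) auto
  then show ?case
    by simp
qed (simp add: arrow_refl)

text \<open>(A1) trades one monomial for at least one, as a regular vertex emits an edge; (A2) and
  (A3) trade one monomial for an improper one plus targets.\<close>

lemma arrow1_size:
  assumes "arrow1 G a b"
  shows "size a \<le> size b"
  using assms
proof (induction rule: arrow1_induct)
  case (A1 a v m)
  then show ?case
    by (simp add: regular_vertex_def card_gt_0_iff Suc_le_eq)
qed auto

lemma arrow_size:
  assumes "arrow G a b"
  shows "size a \<le> size b"
proof -
  from assms have "(arrow1 G)\<^sup>*\<^sup>* a b"
    by (simp add: arrow_def)
  then show ?thesis
    by induction (auto dest: arrow1_size)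
qed

lemma sim_F:
  assumes "sim G a b"
  shows "a \<in> F\<^sub>\<Gamma> G" "b \<in> F\<^sub>\<Gamma> G"
proof -
  have "a \<in> F\<^sub>\<Gamma> G \<and> b \<in> F\<^sub>\<Gamma> G"
    using assms by induction (auto dest: arrow_F)
  then show "a \<in> F\<^sub>\<Gamma> G" "b \<in> F\<^sub>\<Gamma> G"
    by auto
qed

subsection \<open>Expansion to a given degree\<close>

text \<open>
  Infinite emitters have no canonical expansion; the finite arc set \<open>A\<close> selects one. An
  infinite emitter that meets no arc of \<open>A\<close> is treated like a sink.
\<close>

fun expand1 :: "'b set \<Rightarrow> int \<times> ('a, 'b) generator \<Rightarrow> ('a, 'b) elt" where
  "expand1 A (m, Proper v) =
     (if regular_vertex G v then targets m (out_arcs G v)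
      else if infinite_emitter G v \<and> A \<inter> out_arcs G v \<noteq> {}
      then monomial m (Improper v (A \<inter> out_arcs G v)) + targets m (A \<inter> out_arcs G v)
      else monomial m (Proper v))"
| "expand1 A (m, Improper v Z) =
     (if infinite_emitter G v \<and> Z \<noteq> {} \<and> Z \<subseteq> A \<inter> out_arcs G v
      then monomial m (Improper v (A \<inter> out_arcs G v)) + targets m (A \<inter> out_arcs G v - Z)
      else monomial m (Improper v Z))"

primrec expand_upto :: "'b set \<Rightarrow> nat \<Rightarrow> int \<times> ('a, 'b) generator \<Rightarrow> ('a, 'b) elt" where
  "expand_upto A 0 x = {#x#}"
| "expand_upto A (Suc k) x = (\<Sum>y \<in># expand1 A x. expand_upto A k y)"

text \<open>A monomial of degree \<open>m\<close> receives \<open>L - m\<close> rounds;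
  \<open>nat\<close> truncates this to none once \<open>m\<close> has reached
  \<open>L\<close>.\<close>

definition expand :: "'b set \<Rightarrow> int \<Rightarrow> ('a, 'b) elt \<Rightarrow> ('a, 'b) elt" where
  "expand A L a = (\<Sum>x \<in># a. expand_upto A (nat (L - fst x)) x)"

lemma expand_empty [simp]: "expand A L {#} = {#}"
  by (simp add: expand_def)

lemma expand_add [simp]: "expand A L (a + b) = expand A L a + expand A L b"
  by (simp add: expand_def)

lemma expand_sum_mset: "expand A L (\<Sum>x \<in># M. f x) = (\<Sum>x \<in># M. expand A L (f x))"
  by (induction M) auto

lemma expand_eq_sum_mset: "expand A L a = (\<Sum>x \<in># a. expand A L {#x#})"
  by (simp add: expand_def)

lemma expand_upto_fixed:
  "expand1 A x = {#x#} \<Longrightarrow> expand_upto A k x = {#x#}"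
  by (induction k) auto

text \<open>What keeps its degree is final: either nothing could be expanded, or it is the improper
  vertex with index set \<open>A \<inter> out_arcs G v\<close>, whose next round adds only an empty
  target sum. Hence one round per degree suffices.\<close>

lemma expand1_cases:
  assumes "y \<in># expand1 A (m, g)"
  obtains "expand1 A y = {#y#}" "fst y = m" | "fst y = m + 1"
proof -
  have [simp]: "targets m {} = {#}" for m
    by (simp add: targets_def)
  have [simp]: "fst z = n + 1" if "z \<in># targets n Z" for z n Z
    using that by (auto simp: targets_def)
  from assms have "(expand1 A y = {#y#} \<and> fst y = m) \<or> fst y = m + 1"
    by (cases g) (auto split: if_splits)
  with that show ?thesis by blast
qed

text \<open>After one round, monomials of degree \<open>m + 1\<close> need exactly one round less,
  and those still at degree \<open>m\<close> are fixed, so any number of further rounds leaves them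
  alone.\<close>

lemma expand_expand1:
  assumes "m < L"
  shows "expand A L (expand1 A (m, g)) = expand A L {#(m, g)#}"
proof -
  obtain k where k: "nat (L - m) = Suc k"
    using assms by (cases "nat (L - m)") auto
  have "expand_upto A (nat (L - fst y)) y = expand_upto A k y"
    if "y \<in># expand1 A (m, g)" for y
    using that
  proof (cases rule: expand1_cases)
    case 1
    then show ?thesis by (simp add: expand_upto_fixed)
  next
    case 2
    then have "nat (L - fst y) = k" using k by linarith
    then show ?thesis by simp
  qed
  then have "expand A L (expand1 A (m, g)) = (\<Sum>y \<in># expand1 A (m, g). expand_upto A k y)"
    unfolding expand_def by (intro arg_cong[of _ _ sum_mset] image_mset_cong)
  also have "\<dots> = expand A L {#(m, g)#}"
    by (simp add: expand_def k)
  finally show ?thesis .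
qed

text \<open>A round raises degrees by at most one, so each of the \<open>k\<close> rounds acts on
  degrees below \<open>L\<close>, where \<open>expand_expand1\<close> applies.\<close>

lemma expand_expand_upto:
  "fst x + int k \<le> L \<Longrightarrow> expand A L (expand_upto A k x) = expand A L {#x#}"
proof (induction k arbitrary: x)
  case (Suc k)
  obtain m g where x: "x = (m, g)"
    by fastforce
  have "expand A L (expand_upto A k y) = expand A L {#y#}" if "y \<in># expand1 A x" for y
    using that[unfolded x]
  proof (cases rule: expand1_cases)
    case 1
    then show ?thesis using Suc.prems x by (intro Suc.IH) auto
  next
    case 2
    then show ?thesis using Suc.prems x by (intro Suc.IH) auto
  qed
  then have "expand A L (expand_upto A (Suc k) x) = (\<Sum>y \<in># expand1 A x. expand A L {#y#})"
    by (simp add: expand_sum_mset image_mset.compositionality o_def cong: image_mset_cong)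
  also have "\<dots> = expand A L (expand1 A x)"
    by (simp add: expand_eq_sum_mset[symmetric])
  also have "\<dots> = expand A L {#x#}"
    using Suc.prems x by (simp add: expand_expand1)
  finally show ?case .
qed simp

lemma expand_expand:
  assumes "K \<le> L"
  shows "expand A L (expand A K a) = expand A L a"
proof -
  \<comment> \<open>Above degree \<open>K\<close> the inner expansion performs zero rounds.\<close>
  have "expand A L (expand_upto A (nat (K - fst x)) x) = expand A L {#x#}" for x
  proof (cases "fst x \<le> K")
    case True
    then show ?thesis using assms by (intro expand_expand_upto) auto
  qed simp
  then show ?thesis
    by (simp add: expand_def[of A K] expand_sum_mset expand_eq_sum_mset[symmetric])
qed

lemma act_expand1: "act n (expand1 A (m, g)) = expand1 A (n + m, g)"
  by (cases g) auto

lemma act_expand_upto: "act n (expand_upto A k (m, g)) = expand_upto A k (n + m, g)"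
proof (induction k arbitrary: m g)
  case (Suc k)
  have "act n (expand_upto A (Suc k) (m, g)) =
      (\<Sum>(i, h) \<in># expand1 A (m, g). expand_upto A k (n + i, h))"
    by (simp add: act_sum_mset image_mset.compositionality o_def case_prod_unfold)
      (simp add: Suc.IH flip: Suc.IH)
  also have "\<dots> = (\<Sum>y \<in># act n (expand1 A (m, g)). expand_upto A k y)"
    by (simp add: act_def image_mset.compositionality o_def case_prod_unfold)
  finally show ?case
    by (simp add: act_expand1)
qed simp

text \<open>The rules ignore absolute degrees, and shifting the element together with the threshold
  preserves the number of rounds.\<close>

lemma act_expand: "act n (expand A L a) = expand A (n + L) (act n a)"
proof (induction a)
  case (add x a)
  obtain m g where x: "x = (m, g)"
    by fastforce
  have "act n (expand A L {#x#}) = expand A (n + L) (act n {#x#})"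
    by (simp add: x expand_def act_expand_upto)
  moreover have "add_mset x a = {#x#} + a"
    by simp
  ultimately show ?case
    using add by (simp only: act_add expand_add)
qed simp

lemma arrow_expand1:
  assumes "finite A" "g \<in> generators G"
  shows "arrow G {#(m, g)#} (expand1 A (m, g))"
proof (cases g)
  case (Proper v)
  with assms show ?thesis
    using arrow1_intros(1)[of "{#}" v m] arrow1_intros(2)[of "{#}" v "A \<inter> out_arcs G v" m]
    by (auto intro: arrow_refl arrow1_imp_arrow)
next
  case (Improper v Z)
  show ?thesis
  proof (cases "Z \<subset> A \<inter> out_arcs G v")
    case True
    with assms Improper show ?thesis
      using arrow1_intros(3)[of "{#}" v "A \<inter> out_arcs G v" Z m]
      by (auto intro: arrow1_imp_arrow)
  next
    case False
    \<comment> \<open>Either \<open>Z\<close> is not contained in \<open>A\<close>, or it already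
      equals \<open>A \<inter> out_arcs G v\<close> and no target is added.\<close>
    with Improper have "expand1 A (m, g) = {#(m, g)#}"
      by (auto simp: targets_def psubset_eq)
    with assms show ?thesis
      by (simp add: arrow_refl)
  qed
qed

lemma arrow_expand_upto:
  assumes "finite A"
  shows "{#x#} \<in> F\<^sub>\<Gamma> G \<Longrightarrow> arrow G {#x#} (expand_upto A k x)"
proof (induction k arbitrary: x)
  case 0
  then show ?case by (simp add: arrow_refl)
next
  case (Suc k)
  obtain m g where x: "x = (m, g)"
    by fastforce
  have 1: "arrow G {#x#} (expand1 A x)"
    using assms Suc.prems by (simp add: x arrow_expand1)
  moreover have "{#y#} \<in> F\<^sub>\<Gamma> G" if "y \<in># expand1 A x" for y
    using arrow_F(2)[OF 1] that by (auto simp: F\<^sub>\<Gamma>_def)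
  then have "arrow G (expand1 A x) (\<Sum>y \<in># expand1 A x. expand_upto A k y)"
    by (intro arrow_sum_mset Suc.IH)
  ultimately show ?case
    by (simp add: arrow_trans)
qed

lemma arrow_expand:
  assumes "finite A" "a \<in> F\<^sub>\<Gamma> G"
  shows "arrow G a (expand A L a)"
  unfolding expand_def
  using assms by (intro arrow_sum_mset arrow_expand_upto) (auto simp: F\<^sub>\<Gamma>_def)

section \<open>Congruent elements have a common expansion\<close>

definition eventually_same :: "('a, 'b) elt \<Rightarrow> ('a, 'b) elt \<Rightarrow> bool" where
  "eventually_same a b \<longleftrightarrow>
     (\<exists>B K. finite B \<and> (\<forall>A L. finite A \<longrightarrow> B \<subseteq> A \<longrightarrow> K \<le> L \<longrightarrow> expand A L a = expand A L b))"

lemma eventually_sameI: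
  "finite B \<Longrightarrow> (\<And>A L. finite A \<Longrightarrow> B \<subseteq> A \<Longrightarrow> K \<le> L \<Longrightarrow> expand A L a = expand A L b) \<Longrightarrow> eventually_same a b"
  unfolding eventually_same_def by blast

text \<open>Bounds combine by union and maximum. This is why agreement is demanded for all larger
  \<open>A\<close> and \<open>L\<close>: it yields transitivity and additivity.\<close>

lemma eventually_same_common:
  assumes "eventually_same a b" "eventually_same c d"
  obtains B K where "finite B"
    "\<And>A L. finite A \<Longrightarrow> B \<subseteq> A \<Longrightarrow> K \<le> L \<Longrightarrow> expand A L a = expand A L b"
    "\<And>A L. finite A \<Longrightarrow> B \<subseteq> A \<Longrightarrow> K \<le> L \<Longrightarrow> expand A L c = expand A L d"
proof -
  obtain B K where "finite B"
    "\<And>A L. finite A \<Longrightarrow> B \<subseteq> A \<Longrightarrow> K \<le> L \<Longrightarrow> expand A L a = expand A L b"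
    using assms(1) unfolding eventually_same_def by blast
  moreover obtain B' K' where "finite B'"
    "\<And>A L. finite A \<Longrightarrow> B' \<subseteq> A \<Longrightarrow> K' \<le> L \<Longrightarrow> expand A L c = expand A L d"
    using assms(2) unfolding eventually_same_def by blast
  ultimately show ?thesis
    by (intro that[of "B \<union> B'" "max K K'"]) auto
qed

lemma expand_Proper_infinite_emitter:
  assumes "infinite_emitter G v" "A \<inter> out_arcs G v \<noteq> {}" "m < L"
  shows "expand A L (monomial m (Proper v)) =
    expand A L (monomial m (Improper v (A \<inter> out_arcs G v))) +
    expand A L (targets m (A \<inter> out_arcs G v))"
proof -
  have "\<not> regular_vertex G v"
    using assms by (auto simp: regular_vertex_def infinite_emitter_def)
  then show ?thesis
    using expand_expand1[of m L A "Proper v"] assms by (simp flip: expand_add)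
qed

lemma expand_Improper:
  assumes "infinite_emitter G v" "Z \<noteq> {}" "Z \<subseteq> A" "Z \<subseteq> out_arcs G v" "m < L"
  shows "expand A L (monomial m (Improper v Z)) =
    expand A L (monomial m (Improper v (A \<inter> out_arcs G v))) +
    expand A L (targets m (A \<inter> out_arcs G v - Z))"
  using expand_expand1[of m L A "Improper v Z"] assms by (simp flip: expand_add)

text \<open>The threshold \<open>m + 1\<close> ensures that the rewritten monomial is expanded. For
  (A1) the rewriting is itself the first round. For (A2) and (A3), once \<open>A\<close> contains
  the new index set, both sides reach the same improper vertex, and the targets emitted by the step
  are exactly those the right side omits later.\<close>

lemma eventually_same_arrow1:
  assumes "arrow1 G a b"
  shows "eventually_same a b"
  using assms
proof (induction rule: arrow1_induct)
  case (A1 a v m)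
  have "expand A L (targets m (out_arcs G v)) = expand A L (monomial m (Proper v))"
    if "m < L" for A L
    using expand_expand1[OF that, of A "Proper v"] A1 by simp
  then show ?case
    by (intro eventually_sameI[of "{}" "m + 1"]) (simp_all only: expand_add, auto)
next
  case (A2 a v Z m)
  show ?case
  proof (rule eventually_sameI[of Z "m + 1"])
    fix A L assume A: "finite A" "Z \<subseteq> A" and L: "m + 1 \<le> L"
    let ?V = "A \<inter> out_arcs G v"
    have V: "Z \<subseteq> ?V" "?V \<noteq> {}"
      using A A2 by auto
    then have "expand A L (targets m ?V) =
        expand A L (targets m Z) + expand A L (targets m (?V - Z))"
      using targets_Diff[of ?V Z m] A by simp
    then show "expand A L (a + monomial m (Proper v)) =
      expand A L (a + monomial m (Improper v Z) + targets m Z)"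
      unfolding expand_add
      using expand_Proper_infinite_emitter[of v A m L] expand_Improper[of v Z A m L] A A2 L V(2)
      by (simp add: ac_simps)
  qed (use A2 in auto)
next
  case (A3 a v W Z m)
  show ?case
  proof (rule eventually_sameI[of W "m + 1"])
    fix A L assume A: "finite A" "W \<subseteq> A" and L: "m + 1 \<le> L"
    let ?V = "A \<inter> out_arcs G v"
    have "?V - Z - (W - Z) = ?V - W" "W - Z \<subseteq> ?V - Z"
      using A3 A by auto
    then have "expand A L (targets m (?V - Z)) =
        expand A L (targets m (W - Z)) + expand A L (targets m (?V - W))"
      using targets_Diff[of "?V - Z" "W - Z" m] A by simp
    moreover have "W \<noteq> {}" "Z \<subseteq> A" "Z \<subseteq> out_arcs G v"
      using A3 A by auto
    ultimately show "expand A L (a + monomial m (Improper v Z)) =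
      expand A L (a + monomial m (Improper v W) + targets m (W - Z))"
      unfolding expand_add
      using expand_Improper[of v Z A m L] expand_Improper[of v W A m L] A A3 L
      by (simp add: ac_simps)
  qed (use A3 in auto)
qed

lemma eventually_same_refl: "eventually_same a a"
  by (rule eventually_sameI[of "{}"]) auto

lemma eventually_same_trans:
  assumes "eventually_same a b" "eventually_same b c"
  shows "eventually_same a c"
  using assms
proof (rule eventually_same_common)
  fix B K
  assume "finite B"
    "\<And>A L. finite A \<Longrightarrow> B \<subseteq> A \<Longrightarrow> K \<le> L \<Longrightarrow> expand A L a = expand A L b"
    "\<And>A L. finite A \<Longrightarrow> B \<subseteq> A \<Longrightarrow> K \<le> L \<Longrightarrow> expand A L b = expand A L c"
  then show ?thesis
    by (intro eventually_sameI[of B K]) simp_all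
qed

lemma eventually_same_arrow:
  assumes "arrow G a b"
  shows "eventually_same a b"
proof -
  from assms have "(arrow1 G)\<^sup>*\<^sup>* a b"
    by (simp add: arrow_def)
  then show ?thesis
    by induction
      (auto intro: eventually_same_refl eventually_same_trans eventually_same_arrow1)
qed

lemma sim_imp_eventually_same:
  assumes "sim G a b"
  shows "eventually_same a b"
  using assms
proof induction
  case (sim_add a b c d)
  from sim_add.IH show ?case
  proof (rule eventually_same_common)
    fix B K
    assume "finite B"
      "\<And>A L. finite A \<Longrightarrow> B \<subseteq> A \<Longrightarrow> K \<le> L \<Longrightarrow> expand A L a = expand A L b"
      "\<And>A L. finite A \<Longrightarrow> B \<subseteq> A \<Longrightarrow> K \<le> L \<Longrightarrow> expand A L c = expand A L d"
    then show "eventually_same (a + c) (b + d)"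
      by (intro eventually_sameI[of B K]) simp_all
  qed
next
  case (sim_act a b n)
  from sim_act.IH obtain B K where "finite B"
    "\<And>A L. finite A \<Longrightarrow> B \<subseteq> A \<Longrightarrow> K \<le> L \<Longrightarrow> expand A L a = expand A L b"
    unfolding eventually_same_def by blast
  \<comment> \<open>A shift by \<open>n\<close> moves the threshold, so \<open>K\<close> becomes
    \<open>K + n\<close>.\<close>
  moreover have "expand A L (act n c) = act n (expand A (L - n) c)" for A L c
    by (simp add: act_expand)
  ultimately show ?case
    by (intro eventually_sameI[of B "K + n"]) auto
next
  case (sim_sym a b)
  then show ?case
    unfolding eventually_same_def by metis
qed (auto intro: eventually_same_arrow eventually_same_refl eventually_same_trans)

text \<open>By \<open>arrow_expand\<close> the common value is reached from both \<open>a\<close>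
  and \<open>b\<close>; confluence is used in this form.\<close>

lemma sim_expand_eq:
  assumes "sim G a b"
  obtains A K where "finite A" "\<And>L. K \<le> L \<Longrightarrow> expand A L a = expand A L b"
  using sim_imp_eventually_same[OF assms] unfolding eventually_same_def by blast

text \<open>Additivity cancels the expansion of \<open>a\<close>, so \<open>b\<close> expands to
  \<open>{#}\<close>.\<close>

lemma sim_self_add_eq_empty:
  assumes "sim G a (a + b)"
  shows "b = {#}"
proof -
  obtain A K where "finite A" "\<And>L. K \<le> L \<Longrightarrow> expand A L a = expand A L (a + b)"
    using sim_expand_eq[OF assms] by blast
  then have "expand A K b = {#}"
    by (metis add_cancel_right_right expand_add order_refl)
  moreover have "b \<in> F\<^sub>\<Gamma> G"
    using sim_F[OF assms] by simp
  ultimately have "size b \<le> 0"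
    using arrow_size[OF arrow_expand[OF \<open>finite A\<close>], of b K] by simp
  then show ?thesis
    by simp
qed

subsection \<open>Stationary elements\<close>

lemma comparable_imp_arrow_stationary:
  assumes "comparable G a" "a \<in> F\<^sub>\<Gamma> G" "a \<noteq> {#}"
  obtains s where "arrow G a s" "stationary G s"
proof -
  obtain n c where n: "n > 0" and c: "c \<in> F\<^sub>\<Gamma> G" "sim G (act n a + c) a"
    using assms(1) by (auto simp: comparable_def precsim_def)
  obtain A K where "finite A" and
    K: "\<And>L. K \<le> L \<Longrightarrow> expand A L (act n a + c) = expand A L a"
    using sim_expand_eq[OF c(2)] by blast
  define s where "s = expand A K a"
  have s: "arrow G a s"
    using \<open>finite A\<close> assms by (simp add: s_def arrow_expand)
  \<comment> \<open>The expansion to \<open>K\<close> is absorbed by the one to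
    \<open>n + K\<close>, and this threshold still satisfies the bound \<open>K\<close> because
    \<open>n > 0\<close>.\<close>
  have "expand A (n + K) s = expand A (n + K) (act n a + c)"
    using n K by (simp add: s_def expand_expand)
  also have "\<dots> = act n s + expand A (n + K) c"
    by (simp add: s_def act_expand)
  finally have "arrow G s (act n s + expand A (n + K) c)"
    using arrow_expand[OF \<open>finite A\<close> arrow_F(2)[OF s], of "n + K"] by simp
  moreover have "expand A (n + K) c \<in> F\<^sub>\<Gamma> G"
    using arrow_F(2)[OF arrow_expand] \<open>finite A\<close> c by blast
  moreover have "s \<noteq> {#}"
    using arrow_size[OF s] assms(3) by auto
  ultimately have "stationary G s"
    using n arrow_F(2)[OF s] by (auto simp: stationary_def)
  with s show ?thesis
    by (rule that)
qed

text \<open>Substituting the relation into itself yields all multiples of a period, from which two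
  stationary elements get a common one.\<close>

lemma arrow_act_iterate:
  assumes "arrow G a (act n a + b)" "b \<in> F\<^sub>\<Gamma> G"
  shows "\<exists>c \<in> F\<^sub>\<Gamma> G. arrow G a (act (int k * n) a + c)"
proof (induction k)
  case 0
  show ?case
    using arrow_F(1)[OF assms(1)] by (auto intro!: bexI[of _ "{#}"] arrow_refl)
next
  case (Suc k)
  then obtain c where c: "c \<in> F\<^sub>\<Gamma> G" "arrow G a (act (int k * n) a + c)"
    by blast
  let ?c = "act (int k * n) b + c"
  have "arrow G (act (int k * n) a) (act (int k * n) (act n a + b))"
    using assms(1) by (rule arrow_act)
  from arrow_add_left[OF this c(1)]
  have "arrow G (act (int k * n) a + c) (act (int (Suc k) * n) a + ?c)"
    by (simp add: add.assoc add.commute add.left_commute distrib_right)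
  with c have "arrow G a (act (int (Suc k) * n) a + ?c)"
    by (blast intro: arrow_trans)
  with c(1) assms(2) show ?case
    by (intro bexI[of _ ?c]) auto
qed

lemma stationary_add:
  assumes "stationary G a" "stationary G b"
  shows "stationary G (a + b)"
proof -
  obtain m c where m: "m > 0" "c \<in> F\<^sub>\<Gamma> G" "arrow G a (act m a + c)"
    using assms(1) by (auto simp: stationary_def)
  obtain n d where n: "n > 0" "d \<in> F\<^sub>\<Gamma> G" "arrow G b (act n b + d)"
    using assms(2) by (auto simp: stationary_def)
  \<comment> \<open>The product \<open>m * n\<close> serves as a period for both summands.\<close>
  obtain c' where "c' \<in> F\<^sub>\<Gamma> G" "arrow G a (act (m * n) a + c')"
    using arrow_act_iterate[OF m(3,2), of "nat n"] n(1) by (auto simp: mult.commute)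
  moreover obtain d' where "d' \<in> F\<^sub>\<Gamma> G" "arrow G b (act (m * n) b + d')"
    using arrow_act_iterate[OF n(3,2), of "nat m"] m(1) by auto
  ultimately have "arrow G (a + b) (act (m * n) (a + b) + (c' + d'))" "c' + d' \<in> F\<^sub>\<Gamma> G"
    using arrow_add[of a "act (m * n) a + c'" b "act (m * n) b + d'"] by (auto simp: ac_simps)
  moreover have "m * n > 0"
    using m n by simp
  ultimately show ?thesis
    using assms unfolding stationary_def
    by (intro conjI exI[of _ "m * n"] bexI[of _ "c' + d'"]) auto
qed

lemma stationary_act:
  assumes "stationary G a"
  shows "stationary G (act n a)"
proof -
  obtain m c where "m > 0" "c \<in> F\<^sub>\<Gamma> G" "arrow G a (act m a + c)"
    using assms by (auto simp: stationary_def)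
  moreover from this have "arrow G (act n a) (act m (act n a) + act n c)"
    using arrow_act[of a "act m a + c" n] by (simp add: add.commute)
  ultimately show ?thesis
    using assms unfolding stationary_def by (metis F_act_iff act_eq_empty_iff)
qed

lemma support_add: "support (a + b) = support a \<union> support b"
  by (auto simp: support_def)

lemma support_act [simp]: "support (act n a) = support a"
  by (force simp: support_def act_def)

text \<open>Each monomial flows to a shifted copy of the element chosen for its generator. Shifts
  keep supports and sums unite them, so every core cycle of the total is a core cycle of some
  summand.\<close>

lemma arrow_stationary_with_exits:
  assumes gens: "\<And>g. g \<in> generators G \<Longrightarrow> \<exists>s. arrow G (monomial 0 g) s \<and> stationary G s \<and>
      (\<forall>p. core_cycle G s p \<longrightarrow> has_exit G p)"
    and "a \<in> F\<^sub>\<Gamma> G" "a \<noteq> {#}"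
  shows "\<exists>s. arrow G a s \<and> stationary G s \<and> (\<forall>p. core_cycle G s p \<longrightarrow> has_exit G p)"
  using assms(2,3)
proof (induction a)
  case (add x a)
  obtain m g where x: "x = (m, g)"
    by fastforce
  with add.prems gens obtain s where "arrow G (monomial 0 g) s" "stationary G s"
    "\<forall>p. core_cycle G s p \<longrightarrow> has_exit G p"
    by auto
  then have s: "arrow G {#x#} (act m s)" "stationary G (act m s)"
    "\<forall>p. core_cycle G (act m s) p \<longrightarrow> has_exit G p"
    using arrow_act[of "monomial 0 g" s m] by (auto simp: x stationary_act core_cycle_def)
  show ?case
  \<comment> \<open>The induction hypothesis covers nonzero elements only.\<close>
  proof (cases "a = {#}")
    case True
    with s show ?thesis by auto
  next
    case False
    with add obtain t where t: "arrow G a t" "stationary G t"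
      "\<forall>p. core_cycle G t p \<longrightarrow> has_exit G p"
      by (auto simp: x)
    have "arrow G (add_mset x a) (act m s + t)"
      using arrow_add[OF s(1) t(1)] by simp
    with s t show ?thesis
      by (intro exI[of _ "act m s + t"])
        (auto simp: stationary_add core_cycle_def support_add)
  qed
qed simp

subsection \<open>Cycles without exits\<close>

text \<open>The motion of one monomial along the only edge of its vertex: the effect of the
  rewriting steps that preserve size.\<close>

definition single_step :: "int \<times> ('a, 'b) generator \<Rightarrow> int \<times> ('a, 'b) generator \<Rightarrow> bool" where
  "single_step x y \<longleftrightarrow> (\<exists>v e. v \<in> verts G \<and> out_arcs G v = {e} \<and>
     snd x = Proper v \<and> y = (fst x + 1, Proper (head G e)))"

text \<open>(A2) and (A3) add at least one monomial, since \<open>Z\<close> and \<open>W - Z\<close>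
  are nonempty. Only (A1) at a vertex with a single edge remains.\<close>

lemma arrow1_same_size:
  assumes "arrow1 G a b" "size a = size b" "x \<in># a"
  shows "\<exists>y. y \<in># b \<and> single_step\<^sup>*\<^sup>* x y"
  using assms
proof (induction rule: arrow1_induct)
  case (A1 a v m)
  then have "card (out_arcs G v) = 1"
    by simp
  then obtain e where e: "out_arcs G v = {e}"
    by (auto simp: card_1_singleton_iff)
  moreover have "single_step (m, Proper v) (m + 1, Proper (head G e))"
    using A1 e by (auto simp: single_step_def regular_vertex_def)
  ultimately show ?case
    using A1 by (cases "x \<in># a") (auto simp: targets_def simp del: split_paired_Ex)
next
  case (A3 a v W Z m)
  then have "card (W - Z) = 0"
    by simp
  with A3 show ?case
    by auto
qed auto

text \<open>Size never drops along the rewriting, so equality at the two ends forces it at every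
  intermediate step.\<close>

lemma arrow_same_size:
  assumes "arrow G a b" "size a = size b" "x \<in># a"
  obtains y where "y \<in># b" "single_step\<^sup>*\<^sup>* x y"
proof -
  from assms(1) have "(arrow1 G)\<^sup>*\<^sup>* a b" "a \<in> F\<^sub>\<Gamma> G"
    by (auto simp: arrow_def)
  then have "\<exists>y. y \<in># b \<and> single_step\<^sup>*\<^sup>* x y"
    using assms(2)
  proof induction
    case (step b c)
    have "arrow G a b"
      using step by (simp add: arrow_def)
    then have "size b = size a"
      using arrow_size[of a b] arrow1_size[OF step(2)] step(5) by simp
    with step obtain y where "y \<in># b" "single_step\<^sup>*\<^sup>* x y"
      by auto
    moreover from this obtain z where "z \<in># c" "single_step\<^sup>*\<^sup>* y z"
      using arrow1_same_size[OF step(2), of y] \<open>size b = size a\<close> step(5) by (metis (no_types))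
    ultimately show ?case
      by (blast intro: rtranclp_trans)
  qed (use assms(3) in blast)
  with that show ?thesis by blast
qed

lemma single_step_act:
  assumes "single_step\<^sup>*\<^sup>* (m, g) (i, h)"
  shows "single_step\<^sup>*\<^sup>* (n + m, g) (n + i, h)"
  using assms
proof (induction "(i, h)" arbitrary: i h rule: rtranclp_induct)
  case (step y)
  have "single_step (n + fst y, snd y) (n + i, h)"
    using step(2) by (auto simp: single_step_def)
  moreover have "single_step\<^sup>*\<^sup>* (n + m, g) (n + fst y, snd y)"
    using step(3)[of "fst y" "snd y"] by simp
  ultimately show ?case
    by (rule rtranclp.rtrancl_into_rtrancl[rotated])
qed simp

lemma single_step_awalk:
  assumes "single_step\<^sup>*\<^sup>* (m, Proper v) y" "v \<in> verts G"
  shows "\<exists>p w. y = (m + int (length p), Proper w) \<and> awalk v p w \<and>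
    (\<forall>e \<in> set p. out_arcs G (tail G e) = {e})"
  using assms(1)
proof induction
  case base
  with assms(2) show ?case
    by (intro exI[of _ "[]"]) (auto simp: awalk_Nil_iff)
next
  case (step y z)
  then obtain p w where p: "y = (m + int (length p), Proper w)" "awalk v p w"
    "\<forall>e \<in> set p. out_arcs G (tail G e) = {e}"
    by blast
  with step(2) obtain e where e: "out_arcs G w = {e}" "z = (fst y + 1, Proper (head G e))"
    by (auto simp: single_step_def)
  then have "e \<in> arcs G" "tail G e = w"
    by (auto simp: out_arcs_def)
  then have "awalk v (p @ [e]) (head G e)"
    using p by (auto intro: arc_implies_awalk)
  with p e \<open>tail G e = w\<close> show ?case
    by (intro exI[of _ "p @ [e]"]) auto
qed

text \<open>A shortest such closed walk at \<open>v\<close> repeats no source, and each of its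
  vertices emits only the edge that the walk uses.\<close>

lemma closed_awalk_single_imp_cycle:
  assumes "awalk v p v" "p \<noteq> []" "\<forall>e \<in> set p. out_arcs G (tail G e) = {e}"
  obtains c where "cycle c" "v \<in> tail G ` set c" "\<not> has_exit G c"
proof -
  define P where "P q \<longleftrightarrow> awalk v q v \<and> q \<noteq> [] \<and>
    (\<forall>e \<in> set q. out_arcs G (tail G e) = {e})" for q
  have "P p"
    using assms by (simp add: P_def)
  then obtain q where q: "P q" and min: "\<And>r. P r \<Longrightarrow> length q \<le> length r"
    using ex_has_least_nat[of P p length] by blast
  have "distinct (map (tail G) q)"
  proof (rule ccontr)
    assume "\<not> distinct (map (tail G) q)"
    then obtain xs y ys zs where "map (tail G) q = xs @ [y] @ ys @ [y] @ zs"
      using not_distinct_decomp by blast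
    then obtain as b bs c cs where *: "q = as @ b # bs @ c # cs" "tail G b = tail G c"
      by (auto simp: map_eq_append_conv append_eq_map_conv map_eq_Cons_conv Cons_eq_map_conv)
    have "awalk v (as @ b # bs @ c # cs) v"
      using q * by (simp add: P_def)
    then have "awalk v as (tail G b)" "awalk (tail G c) (c # cs) v"
      by (auto simp: awalk_Cons_iff)
    \<comment> \<open>The detour \<open>b # bs\<close> between two visits to one vertex is cut out;
      \<open>c\<close> keeps the walk nonempty.\<close>
    then have "awalk v (as @ c # cs) v"
      using awalk_appendI *(2) by metis
    then have "P (as @ c # cs)"
      using q by (auto simp: P_def *(1))
    then show False
      using min[of "as @ c # cs"] *(1) by simp
  qed
  with q have "cycle q"
    by (auto simp: cycle_iff_distinct_sources P_def)
  moreover have "v \<in> tail G ` set q"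
    using q by (cases q) (auto simp: P_def awalk_Cons_iff)
  moreover have "\<not> has_exit G q"
    using q by (auto simp: P_def has_exit_def)
  ultimately show ?thesis
    by (rule that)
qed

text \<open>
  No monomial of \<open>a\<close> can split along \<open>a \<rightarrow> x\<^sup>n a\<close>, so each one moves along a single path; as
  \<open>a\<close> is finite, some monomial returns to its own generator.
\<close>

lemma arrow_act_self_imp_cycle:
  assumes "arrow G a (act n a)" "n > 0" "a \<noteq> {#}"
  obtains c where "core_cycle G a c" "\<not> has_exit G c"
proof -
  have step: "\<exists>y. y \<in># a \<and> single_step\<^sup>*\<^sup>* x (n + fst y, snd y)" if "x \<in># a" for x
  proof -
    obtain y where "y \<in># act n a" "single_step\<^sup>*\<^sup>* x y"
      using arrow_same_size[OF assms(1) _ \<open>x \<in># a\<close>] by auto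
    then show ?thesis
      by (intro exI[of _ "(fst y - n, snd y)"]) (cases y, auto simp: mem_act_iff)
  qed
  \<comment> \<open>\<open>f\<close> follows a monomial through one period and shifts the result
    back into \<open>a\<close>; each iteration thus accounts for a degree gain of
    \<open>n\<close>.\<close>
  define f where "f x = (SOME y. y \<in># a \<and> single_step\<^sup>*\<^sup>* x (n + fst y, snd y))" for x
  have f: "f x \<in># a" "single_step\<^sup>*\<^sup>* x (n + fst (f x), snd (f x))" if "x \<in># a" for x
    using someI_ex[OF step[OF that]] by (auto simp: f_def)
  have f_in: "(f ^^ j) x \<in># a" if "x \<in># a" for x j
    using that by (induction j) (auto simp: f(1))
  have steps: "single_step\<^sup>*\<^sup>* x (int j * n + fst ((f ^^ j) x), snd ((f ^^ j) x))"
    if "x \<in># a" for x j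
  proof (induction j)
    case (Suc j)
    have "single_step\<^sup>*\<^sup>* (int j * n + fst ((f ^^ j) x), snd ((f ^^ j) x))
        (int j * n + (n + fst ((f ^^ Suc j) x)), snd ((f ^^ Suc j) x))"
      using f(2)[OF f_in[OF that, of j]] by (intro single_step_act) simp
    with Suc show ?case
      by (simp add: algebra_simps)
  qed simp
  obtain x where x: "x \<in># a"
    using assms(3) by auto
  have "\<not> inj (\<lambda>j. (f ^^ j) x)"
  proof
    assume "inj (\<lambda>j. (f ^^ j) x)"
    moreover have "finite (range (\<lambda>j. (f ^^ j) x))"
      by (rule finite_subset[of _ "set_mset a"]) (auto simp: f_in x)
    ultimately show False
      using finite_imageD by fastforce
  qed
  \<comment> \<open>Pigeonhole: the orbit stays in the finite set of monomials of \<open>a\<close>,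
    so it becomes periodic.\<close>
  then obtain i j where ij: "i < j" "(f ^^ i) x = (f ^^ j) x"
    unfolding inj_def by (metis linorder_neqE_nat)
  define k where "k = j - i"
  obtain m g where y: "(f ^^ i) x = (m, g)"
    by fastforce
  have "(f ^^ k) (m, g) = (m, g)"
    using ij y funpow_add[of k i f, THEN fun_cong, of x] by (simp add: k_def)
  moreover have "(m, g) \<in># a"
    using f_in[OF x, of i] y by simp
  ultimately have *: "single_step\<^sup>*\<^sup>* (m, g) (int k * n + m, g)"
    using steps[of "(m, g)" k] by simp
  have "int k * n > 0"
    using ij assms(2) by (simp add: k_def)
  \<comment> \<open>The degree strictly increases, so the path has a first step, and only proper
    vertices admit one.\<close>
  from * obtain v where v: "g = Proper v" "v \<in> verts G"
    by (rule converse_rtranclpE) (use \<open>int k * n > 0\<close> in \<open>auto simp: single_step_def\<close>)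
  obtain p where
    p: "int k * n = int (length p)" "awalk v p v" "\<forall>e \<in> set p. out_arcs G (tail G e) = {e}"
    using single_step_awalk[of m v "(int k * n + m, g)"] * v by auto
  have "p \<noteq> []"
    using p(1) \<open>int k * n > 0\<close> by auto
  with p obtain c where "cycle c" "v \<in> tail G ` set c" "\<not> has_exit G c"
    using closed_awalk_single_imp_cycle by blast
  moreover have "Proper v \<in> support a"
    using \<open>(m, g) \<in># a\<close> v by (force simp: support_def)
  ultimately show ?thesis
    by (intro that[of c]) (auto simp: core_cycle_def intro!: bexI[of _ "Proper v"])
qed

text \<open>The remainder is a sum of shifts of \<open>c\<close>. Tracking whether it vanishes lets
  one lemma serve both strict comparisons and exact periods.\<close>

lemma sim_iterate:
  assumes "sim G a (act n a + c)" "k > 0"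
  shows "\<exists>d. (d = {#} \<longleftrightarrow> c = {#}) \<and> sim G a (act (int k * n) a + d)"
  using assms(2)
proof (induction k)
  case (Suc k)
  show ?case
  proof (cases "k = 0")
    case True
    with assms show ?thesis by auto
  next
    case False
    with Suc obtain d where d: "d = {#} \<longleftrightarrow> c = {#}" "sim G a (act (int k * n) a + d)"
      by auto
    have "d \<in> F\<^sub>\<Gamma> G"
      using sim_F[OF d(2)] by simp
    from sim.sim_add[OF sim.sim_act[OF assms(1), of "int k * n"] sim.sim_refl[OF this]]
    have "sim G (act (int k * n) a + d) (act (int k * n + n) a + (act (int k * n) c + d))"
      by (simp add: add.assoc)
    with d have "sim G a (act (int k * n + n) a + (act (int k * n) c + d))"
      by (blast intro: sim.sim_trans)
    moreover have "int (Suc k) * n = int k * n + n"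
      by (simp add: algebra_simps)
    ultimately show ?thesis
      using d(1) by (intro exI[of _ "act (int k * n) c + d"]) auto
  qed
qed simp

text \<open>Distinct sources allow one cycle edge per vertex, and any other edge would be an
  exit.\<close>

lemma cycle_no_exit_out_arcs:
  assumes "cycle p" "\<not> has_exit G p" "e \<in> set p"
  shows "out_arcs G (tail G e) = {e}"
proof -
  have "distinct (map (tail G) p)" "set p \<subseteq> arcs G"
    using assms(1) by (auto simp: cycle_iff_distinct_sources)
  then have "e' = e" if "e' \<in> set p" "tail G e' = tail G e" for e'
    using that assms(3) by (auto simp: distinct_map inj_on_def)
  moreover have "e' \<in> set p" if "e' \<in> out_arcs G (tail G e)" for e'
    using that assms by (auto simp: has_exit_def)
  ultimately show ?thesis
    using assms(3) \<open>set p \<subseteq> arcs G\<close> by auto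
qed

lemma awalk_single_arrow:
  assumes "awalk u p v" "\<forall>e \<in> set p. out_arcs G (tail G e) = {e}"
  shows "arrow G (monomial m (Proper u)) (monomial (m + int (length p)) (Proper v))"
  using assms
proof (induction p arbitrary: u m)
  case Nil
  then show ?case
    by (auto simp: awalk_Nil_iff intro!: arrow_refl)
next
  case (Cons e p)
  then have e: "tail G e = u" "out_arcs G u = {e}" "u \<in> verts G" "awalk (head G e) p v"
    by (auto simp: awalk_Cons_iff)
  then have "regular_vertex G u"
    by (simp add: regular_vertex_def)
  then have "arrow G (monomial m (Proper u)) (monomial (m + 1) (Proper (head G e)))"
    using arrow1_intros(1)[of "{#}" u m] e
    by (auto simp: targets_def intro: arrow1_imp_arrow)
  moreover have "arrow G (monomial (m + 1) (Proper (head G e)))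
      (monomial (m + 1 + int (length p)) (Proper v))"
    using Cons e by auto
  ultimately show ?case
    by (auto simp: algebra_simps intro: arrow_trans)
qed

text \<open>Without an exit, \<open>v\<close> flows around the cycle to its own shift by
  \<open>length p\<close>. At the common multiple \<open>length p * n\<close> this exact period
  meets the strict comparison from aperiodicity, giving \<open>a \<sim> a + d\<close> with
  \<open>d\<close> nonzero.\<close>

lemma aperiodic_imp_cycle_has_exit:
  assumes "cycle p" "\<And>v. v \<in> tail G ` set p \<Longrightarrow> aperiodic G (monomial 0 (Proper v))"
  shows "has_exit G p"
proof (rule ccontr)
  assume no_exit: "\<not> has_exit G p"
  obtain v where p: "p \<noteq> []" "awalk v p v"
    using assms(1) by (auto simp: cycle_iff_distinct_sources)
  then have "v \<in> tail G ` set p"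
    by (cases p) (auto simp: awalk_Cons_iff)
  define a where "a = (monomial 0 (Proper v) :: ('a, 'b) elt)"
  obtain n c where n: "n > 0" "c \<in> F\<^sub>\<Gamma> G" "sim G (act n a + c) a" "\<not> sim G (act n a) a"
    using assms(2)[OF \<open>v \<in> tail G ` set p\<close>]
    by (auto simp: a_def aperiodic_def prec_def precsim_def)
  then have "c \<noteq> {#}"
    by auto
  then obtain d where d: "d = {#} \<longleftrightarrow> c = {#}" "sim G a (act (int (length p) * n) a + d)"
    using sim_iterate[OF sim.sim_sym[OF n(3)]] p by auto
  have "arrow G a (act (int (length p)) a)"
    using awalk_single_arrow[OF p(2), of 0] cycle_no_exit_out_arcs[OF assms(1) no_exit]
    by (simp add: a_def)
  then have "sim G a (act (int (length p)) a + {#})"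
    by (simp add: sim.sim_arrow)
  then have "sim G a (act (int (length p) * n) a)"
    using sim_iterate[of a "int (length p)" "{#}" "nat n"] n(1) by (auto simp: mult.commute)
  moreover have "d \<in> F\<^sub>\<Gamma> G"
    using sim_F[OF d(2)] by simp
  ultimately have "sim G (a + d) (act (int (length p) * n) a + d)"
    by (blast intro: sim.sim_add sim.sim_refl)
  with d(2) have "sim G a (a + d)"
    by (blast intro: sim.sim_trans sim.sim_sym)
  with d(1) \<open>c \<noteq> {#}\<close> show False
    using sim_self_add_eq_empty by blast
qed

lemma arrow_stationary_imp_aperiodic:
  assumes "arrow G a s" "stationary G s" "\<And>p. core_cycle G s p \<Longrightarrow> has_exit G p"
  shows "aperiodic G a"
proof -
  obtain n b where n: "n > 0" "b \<in> F\<^sub>\<Gamma> G" "arrow G s (act n s + b)" "s \<noteq> {#}"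
    using assms(2) by (auto simp: stationary_def)
  \<comment> \<open>Both \<open>act n a + b\<close> and \<open>a\<close> reduce to
    \<open>act n s + b\<close>, the latter by way of \<open>s\<close>.\<close>
  have as: "sim G (act n a + b) (act n s + b)"
    using assms(1) n(2) by (blast intro: sim_add sim_act sim_arrow sim_refl)
  have a: "sim G a (act n s + b)"
    using assms(1) n(3) by (blast intro: sim_arrow arrow_trans)
  then have "sim G (act n a + b) a"
    using as by (blast intro: sim.sim_trans sim.sim_sym)
  then have "precsim G (act n a) a"
    using n(2) by (auto simp: precsim_def)
  moreover have "\<not> sim G (act n a) a"
  proof
    assume "sim G (act n a) a"
    moreover have "sim G a s" "sim G (act n s) (act n a)"
      using assms(1) by (blast intro: sim_arrow arrow_act sim_sym)+
    ultimately have "sim G (act n s) s"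
      by (blast intro: sim_trans)
    then have "sim G (act n s + b) (s + b)"
      using n(2) by (blast intro: sim.sim_add sim.sim_refl)
    with n(3) have "sim G s (s + b)"
      by (blast intro: sim_arrow sim_trans)
    then have "b = {#}"
      by (rule sim_self_add_eq_empty)
    with n obtain p where "core_cycle G s p" "\<not> has_exit G p"
      using arrow_act_self_imp_cycle[of s n] by auto
    with assms(3) show False
      by blast
  qed
  ultimately show ?thesis
    using n(1) by (auto simp: aperiodic_def prec_def)
qed

end

theorem theorem5p5:
  fixes E :: "('v, 'e) pre_digraph"
  assumes "wf_digraph E"
  defines "cond1 \<equiv> \<forall>a \<in> F\<^sub>\<Gamma> E. a \<noteq> {#} \<longrightarrow> aperiodic E a"
    and "cond2 \<equiv> \<forall>g \<in> generators E. aperiodic E (monomial 0 g)"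
    and "cond3 \<equiv> (\<forall>g \<in> generators E. comparable E (monomial 0 g)) \<and>
                 (\<forall>p. pre_digraph.cycle E p \<longrightarrow> has_exit E p)"
    and "cond4 \<equiv> \<forall>g \<in> generators E. \<exists>a. arrow E (monomial 0 g) a \<and> stationary E a \<and>
                 (\<forall>p. core_cycle E a p \<longrightarrow> has_exit E p)"
  shows "(cond1 \<longleftrightarrow> cond2) \<and> (cond2 \<longleftrightarrow> cond3) \<and> (cond3 \<longleftrightarrow> cond4)"
proof -
  interpret wf_digraph E
    by fact
  \<comment> \<open>The implications run in a circle through (1), (2), (3), (4) and back to
    (1).\<close>
  have "cond2" if "cond1"
    using that by (simp add: cond1_def cond2_def)
  moreover have "cond3" if "cond2"
  proof -
    have "has_exit E p" if "cycle p" for p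
    proof (rule aperiodic_imp_cycle_has_exit[OF that])
      fix v assume "v \<in> tail E ` set p"
      then have "v \<in> verts E"
        using that by (auto simp: cycle_iff_distinct_sources awalk_def)
      then show "aperiodic E (monomial 0 (Proper v))"
        using \<open>cond2\<close> by (simp add: cond2_def)
    qed
    with that show ?thesis
      by (auto simp: cond2_def cond3_def aperiodic_def comparable_def prec_def)
  qed
  moreover have "cond4" if "cond3"
    unfolding cond4_def
  proof
    fix g assume "g \<in> generators E"
    with that have "comparable E (monomial 0 g)" "monomial 0 g \<in> F\<^sub>\<Gamma> E"
      by (auto simp: cond3_def)
    then obtain s where "arrow E (monomial 0 g) s" "stationary E s"
      by (rule comparable_imp_arrow_stationary) simp
    with that show "\<exists>a. arrow E (monomial 0 g) a \<and> stationary E a \<and>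
        (\<forall>p. core_cycle E a p \<longrightarrow> has_exit E p)"
      by (auto simp: cond3_def core_cycle_def)
  qed
  moreover have "cond1" if "cond4"
    unfolding cond1_def
  proof (intro ballI impI)
    fix a assume "a \<in> F\<^sub>\<Gamma> E" "a \<noteq> {#}"
    with that obtain s where "arrow E a s" "stationary E s" "\<forall>p. core_cycle E s p \<longrightarrow> has_exit E p"
      using arrow_stationary_with_exits[of a] by (auto simp: cond4_def)
    then show "aperiodic E a"
      using arrow_stationary_imp_aperiodic by blast
  qed
  ultimately show ?thesis
    by blast
qed

end
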